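(* Let $F$ be a triple system with $f$ vertices and $v \in V(F)$. Then $$r(F(v), K_t^3) < \bigl(r(F, K_t^3)\bigr)^{f}.$$
   Context: A triple system ($3$-graph) $H$ with vertex set $V(H)$ is a collection of $3$-element subsets of $V(H)$, called edges. $K_n^3$ is the complete $3$-graph on $n$ vertices (all $3$-subsets are edges). For $3$-graphs $F, G$, the Ramsey number $r(F,G)$ is the minimum $n$ such that every red/blue coloring of the edges of $K_n^3$ contains a copy of $F$ all of whose edges are red, or a copy of $G$ all of whose edges are blue. For a triple system $F$ and $v \in V(F)$, $F(v)$ denotes the triple system obtained from $F$ by replacing $v$ with two clones $v_1, v_2$: its vertex set is $(V(F) \setminus \{v\}) \cup \{v_1, v_2\}$ with $v_1 \ne v_2$ new vertices, and its edges are the edges of $F$ not containing $v$, together with the triples $(e \setminus \{v\}) \cup \{v_1\}$ and $(e \setminus \{v\}) \cup \{v_2\}$ for each edge $e$ of $F$ containing $v$. In particular no edge of $F(v)$ contains both $v_1$ and $v_2$.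
   Formalization: The formal theorem assumes f ≥ 2 and t ≥ 2; the strict inequality fails in every excluded case (t = 0: 0 < 0; t = 1: 1 < 1; f = 1, t ≥ 2: 2 < 1). *)

theory Defs
  imports "HOL-Library.Ramsey"
begin

record 'a triples =
  verts :: "'a set"
  edges :: "'a set set"

text \<open>\<open>nsets V 3\<close>, also written \<open>[V]\<^bsup>3\<^esup>\<close>, is the library's set of 3-element subsets of \<open>V\<close>.\<close>

definition triple_system :: "'a triples \<Rightarrow> bool" where
  "triple_system F \<longleftrightarrow> finite (verts F) \<and> edges F \<subseteq> nsets (verts F) 3"

definition complete3 :: "nat \<Rightarrow> nat triples" where
  "complete3 n = \<lparr>verts = {..<n}, edges = nsets {..<n} 3\<rparr>"

text \<open>A copy is a not necessarily induced subgraph; isolated vertices of \<open>F\<close> need room as well.\<close>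

definition contains_copy :: "'b triples \<Rightarrow> 'a triples \<Rightarrow> bool" where
  "contains_copy H F \<longleftrightarrow>
     (\<exists>\<phi>. inj_on \<phi> (verts F) \<and> \<phi> ` verts F \<subseteq> verts H \<and> (\<forall>e\<in>edges F. \<phi> ` e \<in> edges H))"

text \<open>A red/blue coloring of the edges of \<open>K\<^sub>n\<^sup>3\<close> is given by its set \<open>R\<close> of red edges.\<close>

definition ramsey_arrow :: "nat \<Rightarrow> 'a triples \<Rightarrow> 'b triples \<Rightarrow> bool" where
  "ramsey_arrow n F G \<longleftrightarrow>
     (\<forall>R \<subseteq> edges (complete3 n).
        contains_copy \<lparr>verts = verts (complete3 n), edges = R\<rparr> F \<or>
        contains_copy \<lparr>verts = verts (complete3 n), edges = edges (complete3 n) - R\<rparr> G)"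

text \<open>For finite \<open>F\<close> and \<open>G\<close> such an \<open>n\<close> exists by Ramsey's theorem for triples.\<close>

definition ramsey_number :: "'a triples \<Rightarrow> 'b triples \<Rightarrow> nat" where
  "ramsey_number F G = (LEAST n. ramsey_arrow n F G)"

text \<open>The triple system \<open>F(v)\<close>. The old vertices are tagged with \<open>Inl\<close>, so that
  \<open>Inr False\<close> and \<open>Inr True\<close> are two new vertices, the clones of \<open>v\<close>.\<close>

definition clone :: "'a triples \<Rightarrow> 'a \<Rightarrow> ('a + bool) triples" where
  "clone F v =
     \<lparr>verts = Inl ` (verts F - {v}) \<union> {Inr False, Inr True},
      edges = {Inl ` e | e. e \<in> edges F \<and> v \<notin> e}
            \<union> {Inl ` (e - {v}) \<union> {Inr False} | e. e \<in> edges F \<and> v \<in> e}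
            \<union> {Inl ` (e - {v}) \<union> {Inr True} | e. e \<in> edges F \<and> v \<in> e}\<rparr>"

lemma triple_system_clone:
  assumes "triple_system F"
  shows "triple_system (clone F v)"
proof -
  have fin: "finite (verts F)"
    using assms unfolding triple_system_def by simp
  have E: "e \<subseteq> verts F \<and> finite e \<and> card e = 3" if "e \<in> edges F" for e
    using assms that unfolding triple_system_def nsets_def by auto
  have new: "Inl ` (e - {v}) \<union> {Inr b} \<in> nsets (verts (clone F v)) 3"
    if "e \<in> edges F" "v \<in> e" for e and b :: bool
  proof -
    have "card (Inl ` (e - {v}) :: ('a + bool) set) = 2"
      using E[OF that(1)] that(2) by (subst card_image) auto
    then have "card (Inl ` (e - {v}) \<union> {Inr b}) = 3"
      using E[OF that(1)] by (subst card_Un_disjoint) auto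
    then show ?thesis
      using E[OF that(1)] by (cases b) (auto simp: nsets_def clone_def)
  qed
  have old: "Inl ` e \<in> nsets (verts (clone F v)) 3" if "e \<in> edges F" "v \<notin> e" for e
    using E[OF that(1)] that(2) by (auto simp: nsets_def clone_def card_image)
  have "edges (clone F v) \<subseteq> nsets (verts (clone F v)) 3"
    using new old by (auto simp: clone_def)
  moreover have "finite (verts (clone F v))"
    using fin by (simp add: clone_def)
  ultimately show ?thesis
    by (simp add: triple_system_def)
qed

end

theory Submission
  imports Defs "HOL-Library.FuncSet"
begin

text \<open>
  Let \<open>r = r(F, K\<^sub>t)\<close> and \<open>N = r\<^sup>f - 1\<close>. In a coloring of \<open>K\<^sub>N\<close> without blue \<open>K\<^sub>t\<close>, every
  \<open>r\<close>-set \<open>S\<close> of vertices contains a red embedding of \<open>F\<close>. If there is no red \<open>F(v)\<close>, then the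
  restriction of an embedding to \<open>V(F) - {v}\<close> determines the whole embedding, so at most
  \<open>binom(N - f, r - f)\<close> sets \<open>S\<close> lead to the same restriction. There are \<open>N(N - 1)\<dots>(N - f + 2)\<close> injections of
  \<open>V(F) - {v}\<close>, and so \<open>binom(N, r) \<le> N(N - 1)\<dots>(N - f + 2) binom(N - f, r - f)\<close>, that is,
  \<open>N - f + 1 \<le> r(r - 1)\<dots>(r - f + 1)\<close>. This contradicts \<open>N = r\<^sup>f - 1\<close> when \<open>f \<ge> 3\<close>
  and \<open>r \<ge> f\<close>. The bound \<open>r \<ge> f\<close> holds for \<open>t \<ge> 3\<close>; the estimate is too weak for \<open>f = 2\<close>, but for \<open>f = 2\<close> or
  \<open>t = 2\<close> one of the two systems has no edges.
\<close>

section \<open>Counting embeddings and gluing two of them\<close>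

lemma binomial_times_fact_eq_prod: "(n choose k) * fact k = (\<Prod>i = 0..<k. n - i)"
proof (induction k)
  case (Suc k)
  have "(n choose Suc k) * fact (Suc k) = (Suc k * (n choose Suc k)) * fact k"
    by (simp only: fact_Suc of_nat_id mult_ac)
  also have "Suc k * (n choose Suc k) = (n - k) * (n choose k)"
    using binomial_absorption[of k n] binomial_absorb_comp[of n k] by simp
  also have "(n - k) * (n choose k) * fact k = (n - k) * ((n choose k) * fact k)"
    by simp
  also have "\<dots> = (\<Prod>i = 0..<Suc k. n - i)"
    by (simp add: Suc.IH)
  finally show ?case .
qed simp

text \<open>In the falling factorial \<open>r(r - 1)...(r - f + 1)\<close> every factor after the
  first is at most \<open>r - 1\<close>. One such factor is kept and the others are relaxed to
  \<open>r\<close>. The kept one leaves a gap of \<open>r ^ (f - 1)\<close> below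
  \<open>r ^ f\<close>, which later absorbs the lower-order terms.\<close>

lemma binomial_times_fact_le:
  assumes "2 \<le> f"
  shows "(r choose f) * fact f \<le> r ^ (f - 1) * (r - 1)"
proof -
  obtain k where f: "f = Suc (Suc k)"
    using assms by (metis Suc_le_D numeral_2_eq_2 Suc_le_mono)
  have "(r choose f) * fact f = (Suc (Suc k) * (r choose Suc (Suc k))) * fact (Suc k)"
    unfolding f by (simp only: fact_Suc[of "Suc k"] of_nat_id mult_ac)
  also have "\<dots> = r * (((r - 1) choose Suc k) * fact (Suc k))"
    by (simp only: binomial_absorption mult.assoc)
  also have "\<dots> \<le> r * (r - 1) ^ Suc k"
    by (intro mult_le_mono2 binomial_fact_pow)
  also have "\<dots> \<le> r * (r ^ k * (r - 1))"
    by (simp add: power_mono mult.commute)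
  finally show ?thesis
    unfolding f by (simp add: mult.assoc)
qed

text \<open>Removing \<open>T\<close> sends the supersets injectively to subsets of
  \<open>W - T\<close>. Only an upper bound can be claimed: if \<open>card T > r\<close>, there is
  no superset, but truncated subtraction makes the right side 1.\<close>

lemma card_supersets_le:
  assumes "finite W" "T \<subseteq> W"
  shows "card {S \<in> nsets W r. T \<subseteq> S} \<le> (card W - card T) choose (r - card T)"
proof -
  have T: "finite T"
    using assms finite_subset by blast
  have "card {S \<in> nsets W r. T \<subseteq> S} \<le> card (nsets (W - T) (r - card T))"
  proof (rule card_inj_on_le)
    show "inj_on (\<lambda>S. S - T) {S \<in> nsets W r. T \<subseteq> S}"
      by (rule inj_onI) blast
    show "(\<lambda>S. S - T) ` {S \<in> nsets W r. T \<subseteq> S} \<subseteq> nsets (W - T) (r - card T)"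
      using T by (auto simp: nsets_def card_Diff_subset)
    show "finite (nsets (W - T) (r - card T))"
      using assms(1) by (simp add: finite_imp_finite_nsets)
  qed
  then show ?thesis
    using assms T by (simp add: card_Diff_subset)
qed

text \<open>This is the double count, freed from colors and triples: \<open>E\<close> will be the
  set of maps that send every edge of \<open>F\<close> to a red triple. The assumption
  \<open>small\<close> is the negation of the inequality that the count would yield if no such pair
  existed.\<close>

lemma injections_differing_at_one_point:
  fixes V :: "'a set" and W :: "'b set" and E :: "('a \<Rightarrow> 'b) set"
  assumes V: "finite V" "v \<in> V" and W: "finite W" and rW: "r \<le> card W"
    and small: "(r choose card V) * fact (card V) < card W - (card V - 1)"
    and E: "\<And>S. S \<in> nsets W r \<Longrightarrow> \<exists>\<phi>\<in>E. inj_on \<phi> V \<and> \<phi> ` V \<subseteq> S"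
  obtains \<phi> \<psi> where "\<phi> \<in> E" "\<psi> \<in> E" "inj_on \<phi> V" "inj_on \<psi> V" "\<phi> ` V \<subseteq> W" "\<psi> ` V \<subseteq> W"
    "\<And>x. x \<in> V - {v} \<Longrightarrow> \<phi> x = \<psi> x" "\<phi> v \<noteq> \<psi> v"
proof -
  define f where "f = card V"
  define N where "N = card W"
  obtain \<Phi> where \<Phi>: "\<And>S. S \<in> nsets W r \<Longrightarrow> \<Phi> S \<in> E \<and> inj_on (\<Phi> S) V \<and> \<Phi> S ` V \<subseteq> S"
    using E by metis
  have "nsets W r \<noteq> {}"
    using rW by (simp add: nsets_eq_empty_iff)
  then obtain S1 where S1: "S1 \<in> nsets W r"
    by blast
  have fr: "f \<le> r"
    using \<Phi>[OF S1] S1 card_inj_on_le[of "\<Phi> S1" V S1] by (auto simp: nsets_def f_def)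
  have f1: "1 \<le> f"
    using V unfolding f_def by (metis One_nat_def Suc_leI card_gt_0_iff empty_iff)
  have \<Phi>W: "\<Phi> S ` V \<subseteq> W" if "S \<in> nsets W r" for S
    using \<Phi>[OF that] that by (auto simp: nsets_def)
  have "\<exists>S\<in>nsets W r. \<exists>S'\<in>nsets W r. (\<forall>x\<in>V - {v}. \<Phi> S x = \<Phi> S' x) \<and> \<Phi> S v \<noteq> \<Phi> S' v"
  proof (rule ccontr)
    assume "\<not> ?thesis"
    then have same: "\<Phi> S v = \<Phi> S' v"
      if "S \<in> nsets W r" "S' \<in> nsets W r" "\<And>x. x \<in> V - {v} \<Longrightarrow> \<Phi> S x = \<Phi> S' x" for S S'
      using that by blast
    \<comment> \<open>Extensional functions make the restrictions a finite set whose elements are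
      equal as soon as they agree on \<open>V - {v}\<close>. Choosing one map per
      \<open>r\<close>-set turns the number of \<open>r\<close>-sets into a sum over the fibres of
      \<open>g\<close>.\<close>
    define G where "G = {g \<in> (V - {v}) \<rightarrow>\<^sub>E W. inj_on g (V - {v})}"
    define g where "g = (\<lambda>S. restrict (\<Phi> S) (V - {v}))"
    have finG: "finite G"
      unfolding G_def using V W by (intro finite_Collect_conjI disjI1) (auto intro: finite_PiE)
    have gG: "g S \<in> G" if "S \<in> nsets W r" for S
      using \<Phi>W[OF that] \<Phi>[OF that] unfolding G_def g_def
      by (auto simp: inj_on_restrict_eq intro: inj_on_subset)
    have fibre: "card {S \<in> nsets W r. g S = h} \<le> (N - f) choose (r - f)" for h
    proof (cases "{S \<in> nsets W r. g S = h} = {}")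
      case False
      then obtain S0 where S0: "S0 \<in> nsets W r" "g S0 = h"
        by blast
      \<comment> \<open>By \<open>same\<close>, agreement off \<open>v\<close> extends to
        \<open>v\<close>, so every set in the fibre contains all \<open>f\<close> points of one
        image. With only the \<open>f - 1\<close> points off \<open>v\<close> the count would give
        no contradiction.\<close>
      have "\<Phi> S0 ` V \<subseteq> S" if S: "S \<in> nsets W r" "g S = h" for S
      proof -
        have eq: "\<Phi> S0 x = \<Phi> S x" if "x \<in> V - {v}" for x
        proof -
          have "g S0 x = g S x"
            using S(2) S0(2) by simp
          then show ?thesis
            using that by (simp add: g_def)
        qed
        with same[OF S0(1) S(1)] have "\<Phi> S0 x = \<Phi> S x" if "x \<in> V" for x
          using that by (cases "x = v") auto
        then show ?thesis
          using \<Phi>[OF S(1)] by auto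
      qed
      then have "{S \<in> nsets W r. g S = h} \<subseteq> {S \<in> nsets W r. \<Phi> S0 ` V \<subseteq> S}"
        by blast
      then have "card {S \<in> nsets W r. g S = h} \<le> card {S \<in> nsets W r. \<Phi> S0 ` V \<subseteq> S}"
        using W by (intro card_mono) (auto simp: finite_imp_finite_nsets)
      also have "\<dots> \<le> (card W - card (\<Phi> S0 ` V)) choose (r - card (\<Phi> S0 ` V))"
        using W \<Phi>W[OF S0(1)] by (rule card_supersets_le)
      also have "card (\<Phi> S0 ` V) = f"
        using \<Phi>[OF S0(1)] by (simp add: card_image f_def)
      finally show ?thesis
        by (simp add: N_def)
    qed (simp only: card.empty)
    have "nsets W r = (\<Union>h\<in>G. {S \<in> nsets W r. g S = h})"
      using gG by auto
    then have "N choose r = card (\<Union>h\<in>G. {S \<in> nsets W r. g S = h})"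
      by (metis N_def card_nsets)
    also have "\<dots> \<le> (\<Sum>h\<in>G. card {S \<in> nsets W r. g S = h})"
      using finG by (rule card_UN_le)
    also have "\<dots> \<le> card G * ((N - f) choose (r - f))"
      using sum_bounded_above[of G, OF fibre] by simp
    finally have 1: "N choose r \<le> card G * ((N - f) choose (r - f))" .
    have cG: "card G = (\<Prod>i = 0..<f - 1. N - i)"
      unfolding G_def using V W card_inj_on_subset_funcset[of "V - {v}" W "V - {v}"]
      by (simp add: f_def N_def)
    have pos: "0 < (N - f) choose (r - f)"
      using rW by (simp add: N_def diff_le_mono)
    have Gpos: "0 < card G"
      using gG[OF S1] finG card_gt_0_iff by blast
    \<comment> \<open>Counting \<open>f\<close>-subsets inside \<open>r\<close>-subsets in two ways
      brings out the fibre bound as a common factor, which then cancels without any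
      division.\<close>
    have "((N choose f) * fact f) * ((N - f) choose (r - f)) = (N choose r) * ((r choose f) * fact f)"
      using choose_mult[of f r N] fr rW by (simp add: N_def)
    also have "\<dots> \<le> (card G * ((N - f) choose (r - f))) * ((r choose f) * fact f)"
      using 1 by (rule mult_le_mono1)
    finally have "(N choose f) * fact f \<le> card G * ((r choose f) * fact f)"
      using pos by (simp add: mult.assoc mult.left_commute[of _ "(N - f) choose (r - f)"])
    \<comment> \<open>Both sides are falling factorials of \<open>N\<close>: \<open>card G\<close>
      has the first \<open>f - 1\<close> factors, and \<open>N - (f - 1)\<close> is the last
      one.\<close>
    moreover have "(N choose f) * fact f = card G * (N - (f - 1))"
      unfolding binomial_times_fact_eq_prod cG using f1 prod.atLeast0_lessThan_Suc[of "\<lambda>i. N - i" "f - 1"]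
      by simp
    ultimately have "N - (f - 1) \<le> (r choose f) * fact f"
      using Gpos by simp
    then show False
      using small by (simp add: f_def N_def)
  qed
  then obtain S S' where S: "S \<in> nsets W r" "S' \<in> nsets W r"
      "\<And>x. x \<in> V - {v} \<Longrightarrow> \<Phi> S x = \<Phi> S' x" "\<Phi> S v \<noteq> \<Phi> S' v"
    by blast
  show thesis
    using that[of "\<Phi> S" "\<Phi> S'"] \<Phi> \<Phi>W S by blast
qed

text \<open>The points \<open>\<phi> v\<close> and \<open>\<psi> v\<close> serve as the two clones.
  Neither lies in the common image of the other vertices, because both maps are injective. No edge
  of \<open>F(v)\<close> contains both clones, so each edge is mapped as an edge of \<open>F\<close>
  under \<open>\<phi>\<close> or under \<open>\<psi>\<close>.\<close>

lemma contains_copy_clone: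
  assumes "v \<in> verts F"
    and \<phi>: "inj_on \<phi> (verts F)" "\<phi> ` verts F \<subseteq> verts H" "\<forall>e\<in>edges F. \<phi> ` e \<in> edges H"
    and \<psi>: "inj_on \<psi> (verts F)" "\<psi> ` verts F \<subseteq> verts H" "\<forall>e\<in>edges F. \<psi> ` e \<in> edges H"
    and edges: "edges F \<subseteq> Pow (verts F)"
    and agree: "\<And>x. x \<in> verts F - {v} \<Longrightarrow> \<phi> x = \<psi> x"
    and diff: "\<phi> v \<noteq> \<psi> v"
  shows "contains_copy H (clone F v)"
proof -
  define \<chi> where "\<chi> = case_sum \<phi> (\<lambda>b. if b then \<psi> v else \<phi> v)"
  have "inj_on \<chi> (verts (clone F v))"
    using assms(1) inj_onD[OF \<phi>(1)] inj_onD[OF \<psi>(1)] agree diff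
    unfolding clone_def \<chi>_def by (auto simp: inj_on_def) metis+
  moreover have "\<chi> ` verts (clone F v) \<subseteq> verts H"
    using assms(1) \<phi>(2) \<psi>(2) by (auto simp: clone_def \<chi>_def)
  moreover have "\<chi> ` e' \<in> edges H" if e': "e' \<in> edges (clone F v)" for e'
  proof -
    have "\<exists>e\<in>edges F. \<chi> ` e' = \<phi> ` e \<or> \<chi> ` e' = \<psi> ` e"
    proof -
      consider e where "e \<in> edges F" "v \<notin> e" "e' = Inl ` e"
        | e where "e \<in> edges F" "v \<in> e" "e' = Inl ` (e - {v}) \<union> {Inr False}"
        | e where "e \<in> edges F" "v \<in> e" "e' = Inl ` (e - {v}) \<union> {Inr True}"
        using e' by (auto simp: clone_def)
      then show ?thesis
      proof cases
        case 1
        then have "\<chi> ` e' = \<phi> ` e"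
          by (simp add: \<chi>_def image_image)
        with 1 show ?thesis by blast
      next
        case 2
        then have "\<chi> ` e' = \<phi> ` (e - {v}) \<union> {\<phi> v}"
          by (simp add: \<chi>_def image_image)
        also have "\<dots> = \<phi> ` e"
          using 2 by blast
        finally show ?thesis
          using 2 by blast
      next
        case 3
        then have "\<chi> ` e' = \<phi> ` (e - {v}) \<union> {\<psi> v}"
          by (simp add: \<chi>_def image_image)
        also have "\<phi> ` (e - {v}) = \<psi> ` (e - {v})"
          using 3 edges agree by (intro image_cong) auto
        also have "\<psi> ` (e - {v}) \<union> {\<psi> v} = \<psi> ` e"
          using 3 by blast
        finally show ?thesis
          using 3 by blast
      qed
    qed
    then show ?thesis
      using \<phi>(3) \<psi>(3) by auto
  qed
  ultimately show ?thesis
    unfolding contains_copy_def by blast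
qed

section \<open>Existence and elementary bounds of Ramsey numbers\<close>

lemma ramsey_arrow_exists:
  assumes F: "triple_system F" and G: "triple_system G"
  shows "\<exists>n. ramsey_arrow n F G"
proof -
  obtain n :: nat where n: "partn_lst {..<n} [card (verts F), card (verts G)] 3"
    using ramsey_full by blast
  \<comment> \<open>A set whose triples all lie in \<open>Q\<close> hosts every triple system on
    equally many vertices, so Ramsey's theorem for complete systems suffices.\<close>
  have copy: "contains_copy \<lparr>verts = {..<n}, edges = Q\<rparr> K"
    if K: "triple_system K" and H: "H \<in> nsets {..<n} (card (verts K))" "nsets H 3 \<subseteq> Q"
    for H and Q :: "nat set set" and K :: "'c triples"
  proof -
    obtain \<phi> where \<phi>: "bij_betw \<phi> (verts K) H"
      using K H finite_same_card_bij[of "verts K" H] by (auto simp: triple_system_def nsets_def)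
    have "\<phi> ` e \<in> Q" if "e \<in> edges K" for e
      using bij_betw_nsets[OF \<phi>, of 3] that K H(2)
      by (auto simp: triple_system_def bij_betw_def)
    moreover have "inj_on \<phi> (verts K)" "\<phi> ` verts K \<subseteq> {..<n}"
      using \<phi> H by (auto simp: bij_betw_def nsets_def)
    ultimately show ?thesis
      unfolding contains_copy_def by auto
  qed
  have "ramsey_arrow n F G"
    unfolding ramsey_arrow_def
  proof (intro allI impI)
    fix R assume "R \<subseteq> edges (complete3 n)"
    define c where "c = (\<lambda>e. if e \<in> R then 0 else 1 :: nat)"
    have c: "c \<in> nsets {..<n} 3 \<rightarrow> {..<2}"
      by (auto simp: c_def)
    obtain i H where H: "i < length [card (verts F), card (verts G)]"
        "H \<in> nsets {..<n} ([card (verts F), card (verts G)] ! i)" "c ` nsets H 3 \<subseteq> {i}"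
      by (rule partn_lstE[OF n c]) auto
    have sub: "nsets H 3 \<subseteq> nsets {..<n} 3"
      using H(2) by (intro nsets_mono) (auto simp: nsets_def)
    show "contains_copy \<lparr>verts = verts (complete3 n), edges = R\<rparr> F \<or>
        contains_copy \<lparr>verts = verts (complete3 n), edges = edges (complete3 n) - R\<rparr> G"
    proof (cases "i = 0")
      case True
      then have "nsets H 3 \<subseteq> R"
        using H(3) by (auto simp: c_def split: if_splits)
      then show ?thesis
        using copy[OF F, of H R] True H(2) by (simp add: complete3_def)
    next
      case False
      then have "i = 1"
        using H(1) by simp
      then have "nsets H 3 \<subseteq> nsets {..<n} 3 - R"
        using H(3) sub by (auto simp: c_def split: if_splits)
      then show ?thesis
        using copy[OF G, of H "nsets {..<n} 3 - R"] \<open>i = 1\<close> H(2) by (simp add: complete3_def)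
    qed
  qed
  then show ?thesis ..
qed

lemma triple_system_complete3: "triple_system (complete3 n)"
  by (simp add: triple_system_def complete3_def)

text \<open>The \<open>LEAST\<close> in the definition is attained only because some
  \<open>n\<close> has the arrow property, which is where Ramsey's theorem enters.\<close>

lemma ramsey_arrow_ramsey_number:
  assumes "triple_system F" "triple_system G"
  shows "ramsey_arrow (ramsey_number F G) F G"
  unfolding ramsey_number_def using ramsey_arrow_exists[OF assms] by (rule LeastI_ex)

lemma ramsey_number_le: "ramsey_arrow n F G \<Longrightarrow> ramsey_number F G \<le> n"
  unfolding ramsey_number_def by (rule Least_le)

lemma contains_copy_card_le:
  assumes "contains_copy H F" "finite (verts H)"
  shows "card (verts F) \<le> card (verts H)"
  using assms card_inj_on_le unfolding contains_copy_def by metis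

lemma contains_copy_edgeless:
  assumes "edges F = {}" "finite (verts F)" "finite (verts H)" "card (verts F) \<le> card (verts H)"
  shows "contains_copy H F"
proof -
  obtain \<phi> where "\<phi> ` verts F \<subseteq> verts H" "inj_on \<phi> (verts F)"
    using card_le_inj[OF assms(2-4)] by blast
  then show ?thesis
    using assms(1) unfolding contains_copy_def by blast
qed

text \<open>The arrow property speaks of \<open>{..<r}\<close> only, so the coloring on
  \<open>S\<close> is pulled back along a bijection. A red copy is carried forward into
  \<open>S\<close>; a blue \<open>complete3 t\<close> would be carried into the whole coloring,
  which has none.\<close>

lemma ramsey_arrow_embed:
  fixes F :: "'a triples"
  assumes arrow: "ramsey_arrow r F (complete3 t)" and S: "S \<in> nsets {..<N} r"
    and no_blue: "\<not> contains_copy \<lparr>verts = {..<N}, edges = nsets {..<N} 3 - R\<rparr> (complete3 t)"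
  shows "\<exists>\<phi>. (\<forall>e\<in>edges F. \<phi> ` e \<in> R) \<and> inj_on \<phi> (verts F) \<and> \<phi> ` verts F \<subseteq> S"
proof -
  obtain h where h: "bij_betw h {..<r} S"
    using S finite_same_card_bij[of "{..<r}" S] by (auto simp: nsets_def)
  have inj: "inj_on h {..<r}" and hS: "h ` {..<r} = S"
    using h by (auto simp: bij_betw_def)
  have SN: "S \<subseteq> {..<N}"
    using S by (simp add: nsets_def)
  define R' where "R' = {e \<in> nsets {..<r} 3. h ` e \<in> R}"
  have "R' \<subseteq> edges (complete3 r)"
    by (auto simp: R'_def complete3_def)
  then consider "contains_copy \<lparr>verts = {..<r}, edges = R'\<rparr> F"
    | "contains_copy \<lparr>verts = {..<r}, edges = nsets {..<r} 3 - R'\<rparr> (complete3 t)"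
    using arrow unfolding ramsey_arrow_def by (auto simp: complete3_def)
  then show ?thesis
  proof cases
    case 1
    then obtain \<phi> where \<phi>: "inj_on \<phi> (verts F)" "\<phi> ` verts F \<subseteq> {..<r}" "\<forall>e\<in>edges F. \<phi> ` e \<in> R'"
      by (auto simp: contains_copy_def)
    have "inj_on (h \<circ> \<phi>) (verts F)"
      using \<phi> inj by (meson comp_inj_on inj_on_subset)
    moreover have "(h \<circ> \<phi>) ` verts F \<subseteq> S"
      using \<phi>(2) hS by auto
    moreover have "\<forall>e\<in>edges F. (h \<circ> \<phi>) ` e \<in> R"
      using \<phi>(3) by (auto simp: R'_def image_comp)
    ultimately show ?thesis by blast
  next
    case 2
    then obtain \<phi> where \<phi>: "inj_on \<phi> {..<t}" "\<phi> ` {..<t} \<subseteq> {..<r}"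
        "\<forall>e\<in>nsets {..<t} 3. \<phi> ` e \<in> nsets {..<r} 3 - R'"
      by (auto simp: contains_copy_def complete3_def)
    have "inj_on (h \<circ> \<phi>) {..<t}"
      using \<phi> inj by (meson comp_inj_on inj_on_subset)
    moreover have "(h \<circ> \<phi>) ` {..<t} \<subseteq> {..<N}"
      using \<phi>(2) hS SN by auto
    moreover have "(h \<circ> \<phi>) ` e \<in> nsets {..<N} 3 - R" if "e \<in> nsets {..<t} 3" for e
    proof -
      have e: "\<phi> ` e \<in> nsets {..<r} 3" "\<phi> ` e \<notin> R'"
        using \<phi>(3) that by auto
      have "h ` \<phi> ` e \<in> nsets S 3"
        using bij_betw_nsets[OF h, of 3] e(1) by (auto simp: bij_betw_def)
      then show ?thesis
        using nsets_mono[OF SN, of 3] e by (auto simp: R'_def image_comp)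
    qed
    ultimately have "contains_copy \<lparr>verts = {..<N}, edges = nsets {..<N} 3 - R\<rparr> (complete3 t)"
      unfolding contains_copy_def by (intro exI[of _ "h \<circ> \<phi>"]) (simp add: complete3_def)
    with no_blue show ?thesis ..
  qed
qed

text \<open>Color every triple red. For \<open>t \<ge> 3\<close> the system
  \<open>complete3 t\<close> has an edge, so there is no blue copy and \<open>F\<close> itself must
  fit. For \<open>t = 2\<close> two vertices already give a blue copy, however large
  \<open>F\<close> is.\<close>

lemma ramsey_arrow_ge_card:
  assumes "ramsey_arrow n F (complete3 t)" "t \<ge> 3"
  shows "card (verts F) \<le> n"
proof -
  have "\<not> contains_copy \<lparr>verts = {..<n}, edges = {}\<rparr> (complete3 t)"
    using assms(2) by (auto simp: contains_copy_def complete3_def nsets_eq_empty_iff)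
  then have "contains_copy \<lparr>verts = {..<n}, edges = nsets {..<n} 3\<rparr> F"
    using assms(1)[unfolded ramsey_arrow_def, rule_format, of "nsets {..<n} 3"]
    by (simp add: complete3_def)
  then show ?thesis
    using contains_copy_card_le by fastforce
qed

text \<open>Whichever copy a coloring contains needs two vertices; the all-blue coloring is an
  arbitrary choice.\<close>

lemma ramsey_arrow_ge_2:
  assumes "ramsey_arrow n F (complete3 t)" "t \<ge> 2" "card (verts F) \<ge> 2"
  shows "n \<ge> 2"
proof -
  have "card (verts F) \<le> n \<or> t \<le> n"
    using assms(1)[unfolded ramsey_arrow_def, rule_format, of "{}"]
    by (auto simp: complete3_def dest: contains_copy_card_le)
  then show ?thesis
    using assms by linarith
qed

section \<open>From a triple system to its clone\<close>

lemma card_verts_clone: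
  assumes "finite (verts F)" "v \<in> verts F"
  shows "card (verts (clone F v)) = Suc (card (verts F))"
proof -
  have "Suc (card (verts F - {v})) = card (verts F)"
    using assms by (rule card_Suc_Diff1)
  moreover have "card (Inl ` (verts F - {v}) \<union> {Inr False, Inr True} :: ('a + bool) set)
      = card (verts F - {v}) + 2"
    using assms by (subst card_Un_disjoint) (auto simp: card_image)
  ultimately show ?thesis
    by (simp only: clone_def triples.simps)
qed

text \<open>Without a blue \<open>complete3 t\<close>, every \<open>r\<close>-set hosts a red
  \<open>F\<close>. The count then gives two red copies that differ exactly at \<open>v\<close>, and
  these glue to a red \<open>clone F v\<close>.\<close>

lemma ramsey_arrow_clone:
  assumes F: "triple_system F" "v \<in> verts F" and r: "ramsey_arrow r F (complete3 t)"
    and rN: "r \<le> N"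
    and small: "(r choose card (verts F)) * fact (card (verts F)) < N - (card (verts F) - 1)"
  shows "ramsey_arrow N (clone F v) (complete3 t)"
  unfolding ramsey_arrow_def
proof (intro allI impI disjCI)
  fix R
  assume no_blue: "\<not> contains_copy
      \<lparr>verts = verts (complete3 N), edges = edges (complete3 N) - R\<rparr> (complete3 t)"
  define E where "E = {\<phi>. \<forall>e\<in>edges F. \<phi> ` e \<in> R}"
  have E: "\<exists>\<phi>\<in>E. inj_on \<phi> (verts F) \<and> \<phi> ` verts F \<subseteq> S" if "S \<in> nsets {..<N} r" for S
    using ramsey_arrow_embed[OF r that] no_blue by (auto simp: E_def complete3_def)
  obtain \<phi> \<psi> where "\<phi> \<in> E" "\<psi> \<in> E" "inj_on \<phi> (verts F)" "inj_on \<psi> (verts F)"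
      "\<phi> ` verts F \<subseteq> {..<N}" "\<psi> ` verts F \<subseteq> {..<N}"
      "\<And>x. x \<in> verts F - {v} \<Longrightarrow> \<phi> x = \<psi> x" "\<phi> v \<noteq> \<psi> v"
    by (rule injections_differing_at_one_point[of "verts F" v "{..<N}" r E])
      (use F rN small E in \<open>auto simp: triple_system_def\<close>)
  moreover have "edges F \<subseteq> Pow (verts F)"
    using F(1) by (auto simp: triple_system_def nsets_def)
  ultimately show "contains_copy \<lparr>verts = verts (complete3 N), edges = R\<rparr> (clone F v)"
    using F(2) by (intro contains_copy_clone[of v F \<phi> _ \<psi>]) (auto simp: E_def complete3_def)
qed

theorem theorem3p1:
  fixes F :: "'a triples" and v :: 'a and f t :: nat
  assumes "triple_system F"
    and "card (verts F) = f"
    and "v \<in> verts F"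
    and "f \<ge> 2"
    and "t \<ge> 2"
  shows "ramsey_number (clone F v) (complete3 t) < (ramsey_number F (complete3 t)) ^ f"
proof -
  define r where "r = ramsey_number F (complete3 t)"
  have r: "ramsey_arrow r F (complete3 t)"
    unfolding r_def using assms(1) triple_system_complete3 by (rule ramsey_arrow_ramsey_number)
  have r2: "r \<ge> 2"
    using ramsey_arrow_ge_2[OF r] assms by simp
  \<comment> \<open>The value 4 exceeds the bounds 2 and 3 that the edgeless cases
    \<open>t = 2\<close> and \<open>f = 2\<close> provide.\<close>
  have "r ^ 2 \<le> r ^ f"
    using r2 assms(4) by (intro power_increasing) auto
  moreover have "2 * 2 \<le> r ^ 2"
    unfolding power2_eq_square using r2 by (intro mult_le_mono)
  ultimately have rf4: "4 \<le> r ^ f"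
    by simp
  have fin: "finite (verts F)"
    using assms(1) by (simp add: triple_system_def)
  consider "t = 2" | "t \<ge> 3" "f = 2" | "t \<ge> 3" "f \<ge> 3"
    using assms by linarith
  then show ?thesis
  proof cases
    case 1
    have "edges (complete3 t) = {}"
      using 1 by (simp add: complete3_def nsets_eq_empty_iff)
    then have "ramsey_arrow 2 (clone F v) (complete3 t)"
      unfolding ramsey_arrow_def using 1
      by (auto intro!: contains_copy_edgeless simp: complete3_def)
    from ramsey_number_le[OF this] show ?thesis
      using rf4 unfolding r_def by linarith
  next
    case 2
    have "edges F = {}"
      using assms 2 fin by (auto simp: triple_system_def nsets_eq_empty)
    then have "edges (clone F v) = {}"
      by (simp add: clone_def)
    then have "ramsey_arrow 3 (clone F v) (complete3 t)"
      unfolding ramsey_arrow_def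
      using card_verts_clone[OF fin assms(3)] triple_system_clone[OF assms(1)] assms(2) 2
      by (auto intro!: contains_copy_edgeless simp: complete3_def triple_system_def)
    from ramsey_number_le[OF this] show ?thesis
      using rf4 unfolding r_def by linarith
  next
    case 3
    have fr: "f \<le> r"
      using ramsey_arrow_ge_card[OF r 3(1)] assms(2) by simp
    \<comment> \<open>For \<open>N = r ^ f - 1\<close> the right side of \<open>small\<close> is
      \<open>r ^ f - f\<close>. After the bound on the falling factorial,
      \<open>f < r ^ (f - 1)\<close> remains to be shown. It follows from
      \<open>f \<le> r < 2 * r \<le> r ^ (f - 1)\<close>, whose last step uses
      \<open>f \<ge> 3\<close> and \<open>r \<ge> 2\<close>.\<close>
    have pow: "r ^ f = r ^ (f - 1) * (r - 1) + r ^ (f - 1)"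
    proof -
      have "r ^ f = r ^ (f - 1) * r"
        using assms(4) by (subst power_minus_mult) simp_all
      also have "\<dots> = r ^ (f - 1) * (r - 1 + 1)"
        using r2 by simp
      finally show ?thesis
        by (simp only: distrib_left mult_1_right)
    qed
    have "r ^ 2 \<le> r ^ (f - 1)"
      using r2 3 by (intro power_increasing) auto
    moreover have "r * 2 \<le> r ^ 2"
      unfolding power2_eq_square using r2 by (intro mult_le_mono) auto
    ultimately have big: "r * 2 \<le> r ^ (f - 1)"
      by simp
    have "(r choose f) * fact f \<le> r ^ (f - 1) * (r - 1)"
      using assms(4) by (rule binomial_times_fact_le)
    also have "\<dots> < r ^ f - 1 - (f - 1)"
      using pow big fr r2 by linarith
    finally have small: "(r choose f) * fact f < r ^ f - 1 - (f - 1)" .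
    have "r \<le> r ^ f - 1"
      using pow big r2 by linarith
    then have "ramsey_arrow (r ^ f - 1) (clone F v) (complete3 t)"
      using small unfolding assms(2)[symmetric] by (rule ramsey_arrow_clone[OF assms(1,3) r])
    from ramsey_number_le[OF this] show ?thesis
      using rf4 unfolding r_def by linarith
  qed
qed

end
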